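(* Let $F\in H^{2}(0,\pi)$ be real-valued with $F(x)>0$ for all $x\in[0,\pi]$, and set $a(x)=\sqrt{F(x)}$, $q(x)=a''(x)/a(x)$, $h=a'(0)/a(0)$. For $\rho\in\mathbb{C}$ let $\varphi(\rho,x)$ be the solution of $-y''+q(x)y=\rho^{2}y$ on $(0,\pi)$ with $\varphi(\rho,0)=1$, $\varphi'(\rho,0)=h$, and let $g_0(x)$ be the first coefficient of its Neumann series of Bessel functions representation $$\varphi(\rho,x)=\cos\rho x+\sum_{n=0}^{\infty}(-1)^{n}g_{n}(x)j_{2n}(\rho x).$$ Then $q$, $h$, $a$ and $F$ are recovered from $g_0$ (and, for $a$ and $F$, the number $F(0)$) by $$q(x)=\frac{g_0''(x)}{g_0(x)+1}\ \text{ for almost every } x\in(0,\pi),\qquad h=g_0'(0),$$ $$a(x)=\sqrt{F(0)}\,\bigl(g_0(x)+1\bigr),\qquad F(x)=F(0)\,\bigl(g_0(x)+1\bigr)^{2}\qquad\text{for all } x\in[0,\pi].$$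
   Context: Primes denote derivatives with respect to $x$, and $j_k$ denotes the spherical Bessel function of the first kind of order $k$. It is a known fact that, for real-valued $q\in L_2(0,\pi)$ and real $h$, there are functions $g_n(x)$, independent of $\rho$, such that the displayed series for $\varphi(\rho,x)$ converges pointwise for every $\rho\in\mathbb{C}$, and, for every $x\in[0,\pi]$, uniformly in $\rho$ on compact subsets of $\mathbb{C}$; its first coefficient is $g_0(x)=\varphi(0,x)-1$. Solutions of the differential equation are understood in the Carathéodory sense (in $H^2(0,\pi)$, with the equation holding almost everywhere). *)

theory Defs
  imports "HOL-Analysis.Analysis"
begin

text \<open>Derivative relative to the interval; one-sided at the two endpoints.\<close>

definition D :: "(real \<Rightarrow> 'a::real_normed_vector) \<Rightarrow> real \<Rightarrow> 'a" where
  "D y x = vector_derivative y (at x within {0..pi})"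

definition abs_continuous_on_interval ::
    "real \<Rightarrow> real \<Rightarrow> (real \<Rightarrow> 'a::real_normed_vector) \<Rightarrow> bool" where
  "abs_continuous_on_interval a b f \<longleftrightarrow>
     (\<forall>\<epsilon>>0. \<exists>\<delta>>0. \<forall>P :: (real \<times> real) set.
        finite P \<and> (\<forall>(s, t)\<in>P. a \<le> s \<and> s < t \<and> t \<le> b) \<and>
        disjoint_family_on (\<lambda>(s, t). {s<..<t}) P \<and> (\<Sum>(s, t)\<in>P. t - s) < \<delta>
        \<longrightarrow> (\<Sum>(s, t)\<in>P. norm (f t - f s)) < \<epsilon>)"

definition square_integrable_on_interval :: "(real \<Rightarrow> 'a::euclidean_space) \<Rightarrow> bool" where
  "square_integrable_on_interval f \<longleftrightarrow>
     f \<in> borel_measurable (lebesgue_on {0..pi}) \<and>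
     integrable (lebesgue_on {0..pi}) (\<lambda>x. (norm (f x))\<^sup>2)"

text \<open>
  The Sobolev space H^2(0,pi), each element being given by its continuously differentiable
  representative on the closed interval: y' is absolutely continuous and y'' is square integrable.
  By Lebesgue's theorem the a.e. differentiability clause follows from absolute continuity;
  it is listed so that D (D y) is visibly a genuine derivative almost everywhere.
  Only the values of y on the interval matter.
\<close>

definition in_H2 :: "(real \<Rightarrow> 'a::euclidean_space) \<Rightarrow> bool" where
  "in_H2 y \<longleftrightarrow>
     (\<forall>x\<in>{0..pi}. y differentiable (at x within {0..pi})) \<and>
     abs_continuous_on_interval 0 pi (D y) \<and>
     (AE x in lebesgue_on {0..pi}. D y differentiable (at x within {0..pi})) \<and>
     square_integrable_on_interval (D (D y))"

definition caratheodory_solution ::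
    "(real \<Rightarrow> real) \<Rightarrow> complex \<Rightarrow> (real \<Rightarrow> complex) \<Rightarrow> bool" where
  "caratheodory_solution q \<rho> y \<longleftrightarrow>
     in_H2 y \<and>
     (AE x in lebesgue_on {0..pi}. - D (D y) x + complex_of_real (q x) * y x = \<rho>\<^sup>2 * y x)"

text \<open>
  The everywhere convergent power series of the spherical Bessel function of the first kind,
  j_k(z) = z^k * sum_m (-z^2/2)^m / (m! (2k+2m+1)!!), with the double factorial written
  as a product. It gives the entire function, including the value at z = 0.
\<close>

definition spherical_bessel_j :: "nat \<Rightarrow> complex \<Rightarrow> complex" where
  "spherical_bessel_j k z =
     z ^ k * (\<Sum>m. (- (z\<^sup>2 / 2)) ^ m / (fact m * of_nat (\<Prod>i\<le>k + m. 2 * i + 1)))"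

definition nsbf_term :: "(nat \<Rightarrow> real \<Rightarrow> complex) \<Rightarrow> complex \<Rightarrow> real \<Rightarrow> nat \<Rightarrow> complex" where
  "nsbf_term g \<rho> x n = (- 1) ^ n * g n x * spherical_bessel_j (2 * n) (\<rho> * complex_of_real x)"

definition nsbf_representation ::
    "(complex \<Rightarrow> real \<Rightarrow> complex) \<Rightarrow> (nat \<Rightarrow> real \<Rightarrow> complex) \<Rightarrow> bool" where
  "nsbf_representation \<phi> g \<longleftrightarrow>
     (\<forall>x\<in>{0..pi}.
        (\<forall>\<rho>. nsbf_term g \<rho> x sums (\<phi> \<rho> x - cos (\<rho> * complex_of_real x))) \<and>
        (\<forall>K. compact K \<longrightarrow>
           uniform_limit K (\<lambda>N \<rho>. \<Sum>n<N. nsbf_term g \<rho> x n)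
             (\<lambda>\<rho>. \<phi> \<rho> x - cos (\<rho> * complex_of_real x)) sequentially))"

end

theory Submission
  imports Defs
begin

text \<open>
  The even Bessel functions vanish at the origin except that \<open>j\<^sub>0(0) = 1\<close>, so at \<open>\<rho> = 0\<close> the Neumann
  series reduces to its first term and \<open>g\<^sub>0 + 1 = \<phi>(0, \<cdot>)\<close>. Both \<open>\<phi>(0, \<cdot>)\<close> and \<open>a\<close> solve
  \<open>y'' = q y\<close>, and their initial data are proportional with factor \<open>a(0)\<close>; hence
  \<open>a = a(0) \<phi>(0, \<cdot>)\<close>, from which all the recovery formulas are read off.

  Since \<open>q\<close> is only square integrable, the uniqueness of the Caratheodory solution needs an
  argument. The Wronskian \<open>a y' - a' y\<close> is absolutely continuous and its derivative
  \<open>a y'' - a'' y\<close> vanishes almost everywhere, so it is constant, and it is zero at the left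
  endpoint. As \<open>a\<close> has no zero, \<open>(y / a)' = (a y' - a' y) / a\<^sup>2 = 0\<close> everywhere and \<open>y / a\<close>
  is constant. The analytic core is
  \<open>abs_continuous_zero_derivative_constant\<close>: an absolutely continuous function whose derivative
  vanishes almost everywhere is constant.
\<close>

section \<open>Absolutely continuous functions\<close>

lemma abs_continuousE:
  assumes "abs_continuous_on_interval a b f" "e > 0"
  obtains d where "d > 0"
    "\<And>P :: (real \<times> real) set. finite P \<Longrightarrow> \<forall>(s, t)\<in>P. a \<le> s \<and> s < t \<and> t \<le> b \<Longrightarrow>
       disjoint_family_on (\<lambda>(s, t). {s<..<t}) P \<Longrightarrow> (\<Sum>(s, t)\<in>P. t - s) < d \<Longrightarrow>
       (\<Sum>(s, t)\<in>P. norm (f t - f s)) < e"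
proof -
  obtain d where d: "d > 0 \<and> (\<forall>P :: (real \<times> real) set.
        finite P \<and> (\<forall>(s, t)\<in>P. a \<le> s \<and> s < t \<and> t \<le> b) \<and>
        disjoint_family_on (\<lambda>(s, t). {s<..<t}) P \<and> (\<Sum>(s, t)\<in>P. t - s) < d
        \<longrightarrow> (\<Sum>(s, t)\<in>P. norm (f t - f s)) < e)"
    using assms(1)[unfolded abs_continuous_on_interval_def, rule_format, OF assms(2)] ..
  show thesis
    by (rule that[OF d[THEN conjunct1]]) (rule d[THEN conjunct2, rule_format], intro conjI)
qed

lemma abs_continuous_imp_continuous_on:
  assumes "abs_continuous_on_interval a b f"
  shows "continuous_on {a..b} f"
  unfolding continuous_on_iff
proof (intro ballI allI impI)
  fix x e :: real assume x: "x \<in> {a..b}" and "e > 0"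
  obtain d where d: "d > 0" "\<And>P :: (real \<times> real) set.
        finite P \<Longrightarrow> \<forall>(s, t)\<in>P. a \<le> s \<and> s < t \<and> t \<le> b \<Longrightarrow>
        disjoint_family_on (\<lambda>(s, t). {s<..<t}) P \<Longrightarrow> (\<Sum>(s, t)\<in>P. t - s) < d
        \<Longrightarrow> (\<Sum>(s, t)\<in>P. norm (f t - f s)) < e"
    by (rule abs_continuousE[OF assms \<open>e > 0\<close>]) blast
  have "dist (f x') (f x) < e" if x': "x' \<in> {a..b}" "dist x' x < d" for x'
  proof (cases "x' = x")
    case False
    have "(\<Sum>(s, t)\<in>{(min x x', max x x')}. norm (f t - f s)) < e"
      using x x' False by (intro d(2)) (auto simp: dist_real_def disjoint_family_on_def)
    then show ?thesis
      by (auto simp: dist_norm norm_minus_commute min_def max_def split: if_splits)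
  qed (use \<open>e > 0\<close> in simp)
  with d(1) show "\<exists>d>0. \<forall>x'\<in>{a..b}. dist x' x < d \<longrightarrow> dist (f x') (f x) < e"
    by blast
qed

text \<open>
  Products, differences and Lipschitz functions are instances of one principle: absolute continuity passes to any
  function whose increments are dominated by a fixed multiple of the increments of two
  absolutely continuous functions.
\<close>

lemma abs_continuous_dominated:
  assumes f: "abs_continuous_on_interval a b f" and g: "abs_continuous_on_interval a b g"
    and "M > 0"
    and le: "\<And>s t. s \<in> {a..b} \<Longrightarrow> t \<in> {a..b} \<Longrightarrow>
               norm (u t - u s) \<le> M * (norm (f t - f s) + norm (g t - g s))"
  shows "abs_continuous_on_interval a b u"
  unfolding abs_continuous_on_interval_def
proof (intro allI impI)
  fix e :: real assume "e > 0"
  then have e': "e / (2 * M) > 0" using \<open>M > 0\<close> by simp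
  obtain d where d: "d > 0" "\<And>P :: (real \<times> real) set.
        finite P \<Longrightarrow> \<forall>(s, t)\<in>P. a \<le> s \<and> s < t \<and> t \<le> b \<Longrightarrow>
        disjoint_family_on (\<lambda>(s, t). {s<..<t}) P \<Longrightarrow> (\<Sum>(s, t)\<in>P. t - s) < d
        \<Longrightarrow> (\<Sum>(s, t)\<in>P. norm (f t - f s)) < e / (2 * M)"
    by (rule abs_continuousE[OF f e']) blast
  obtain d' where d': "d' > 0" "\<And>P :: (real \<times> real) set.
        finite P \<Longrightarrow> \<forall>(s, t)\<in>P. a \<le> s \<and> s < t \<and> t \<le> b \<Longrightarrow>
        disjoint_family_on (\<lambda>(s, t). {s<..<t}) P \<Longrightarrow> (\<Sum>(s, t)\<in>P. t - s) < d'
        \<Longrightarrow> (\<Sum>(s, t)\<in>P. norm (g t - g s)) < e / (2 * M)"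
    by (rule abs_continuousE[OF g e']) blast
  show "\<exists>d>0. \<forall>P :: (real \<times> real) set.
        finite P \<and> (\<forall>(s, t)\<in>P. a \<le> s \<and> s < t \<and> t \<le> b) \<and>
        disjoint_family_on (\<lambda>(s, t). {s<..<t}) P \<and> (\<Sum>(s, t)\<in>P. t - s) < d
        \<longrightarrow> (\<Sum>(s, t)\<in>P. norm (u t - u s)) < e"
  proof (intro exI[of _ "min d d'"] conjI allI impI)
    show "min d d' > 0" using d d' by simp
    fix P :: "(real \<times> real) set"
    assume P: "finite P \<and> (\<forall>(s, t)\<in>P. a \<le> s \<and> s < t \<and> t \<le> b) \<and>
        disjoint_family_on (\<lambda>(s, t). {s<..<t}) P \<and> (\<Sum>(s, t)\<in>P. t - s) < min d d'"
    have "(\<Sum>(s, t)\<in>P. norm (u t - u s))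
        \<le> (\<Sum>(s, t)\<in>P. M * (norm (f t - f s) + norm (g t - g s)))"
      using P by (intro sum_mono) (auto intro!: le)
    also have "\<dots> = M * ((\<Sum>(s, t)\<in>P. norm (f t - f s)) + (\<Sum>(s, t)\<in>P. norm (g t - g s)))"
      by (simp add: sum_distrib_left sum.distrib case_prod_unfold distrib_left)
    also have "\<dots> < M * (e / (2 * M) + e / (2 * M))"
      using P \<open>M > 0\<close> by (intro mult_strict_left_mono add_strict_mono d(2) d'(2)) auto
    also have "\<dots> = e" using \<open>M > 0\<close> by (simp add: field_simps)
    finally show "(\<Sum>(s, t)\<in>P. norm (u t - u s)) < e" .
  qed
qed

lemma abs_continuous_cong:
  assumes "abs_continuous_on_interval a b f" "\<And>x. x \<in> {a..b} \<Longrightarrow> g x = f x"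
  shows "abs_continuous_on_interval a b g"
  using assms(2) by (intro abs_continuous_dominated[OF assms(1) assms(1), of 1]) auto

lemma abs_continuous_diff:
  assumes "abs_continuous_on_interval a b f" "abs_continuous_on_interval a b g"
  shows "abs_continuous_on_interval a b (\<lambda>x. f x - g x)"
proof (rule abs_continuous_dominated[OF assms, of 1])
  fix s t
  have "f t - g t - (f s - g s) = (f t - f s) - (g t - g s)" by simp
  then show "norm (f t - g t - (f s - g s)) \<le> 1 * (norm (f t - f s) + norm (g t - g s))"
    by (metis mult_1 norm_triangle_ineq4)
qed simp

lemma abs_continuous_scaleR:
  fixes f :: "real \<Rightarrow> real" and g :: "real \<Rightarrow> 'a::real_normed_vector"
  assumes f: "abs_continuous_on_interval a b f" and g: "abs_continuous_on_interval a b g"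
  shows "abs_continuous_on_interval a b (\<lambda>x. f x *\<^sub>R g x)"
proof -
  have "bounded (f ` {a..b})" "bounded (g ` {a..b})"
    using abs_continuous_imp_continuous_on[OF f] abs_continuous_imp_continuous_on[OF g]
    by (auto intro!: compact_imp_bounded compact_continuous_image)
  then obtain A B where A: "A > 0" "\<And>x. x \<in> {a..b} \<Longrightarrow> norm (f x) \<le> A"
    and B: "B > 0" "\<And>x. x \<in> {a..b} \<Longrightarrow> norm (g x) \<le> B"
    unfolding bounded_pos by auto
  show ?thesis
  proof (rule abs_continuous_dominated[OF f g, of "A + B"])
    show "A + B > 0" using A B by simp
    fix s t assume st: "s \<in> {a..b}" "t \<in> {a..b}"
    have "f t *\<^sub>R g t - f s *\<^sub>R g s = (f t - f s) *\<^sub>R g t + f s *\<^sub>R (g t - g s)"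
      by (simp add: algebra_simps)
    then have "norm (f t *\<^sub>R g t - f s *\<^sub>R g s)
        \<le> norm (f t - f s) * norm (g t) + norm (f s) * norm (g t - g s)"
      by (metis norm_scaleR norm_triangle_ineq real_norm_def)
    also have "\<dots> \<le> norm (f t - f s) * (A + B) + (A + B) * norm (g t - g s)"
      using A(1) B(1) A(2)[OF st(1)] B(2)[OF st(2)]
      by (intro add_mono mult_mono) auto
    finally show "norm (f t *\<^sub>R g t - f s *\<^sub>R g s)
        \<le> (A + B) * (norm (f t - f s) + norm (g t - g s))"
      by (simp add: algebra_simps)
  qed
qed

lemma continuous_derivative_imp_abs_continuous:
  assumes der: "\<And>x. x \<in> {a..b} \<Longrightarrow> (f has_vector_derivative f' x) (at x within {a..b})"
    and cont: "continuous_on {a..b} f'"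
  shows "abs_continuous_on_interval a b f"
proof -
  have id: "abs_continuous_on_interval a b (\<lambda>x::real. x)"
    unfolding abs_continuous_on_interval_def
  proof (intro allI impI)
    fix e :: real assume e: "e > 0"
    have "(\<Sum>(s, t)\<in>P. norm (t - s)) = (\<Sum>(s, t)\<in>P. t - s)"
      if "\<forall>(s, t)\<in>P. a \<le> s \<and> s < t \<and> t \<le> b" for P :: "(real \<times> real) set"
      using that by (intro sum.cong) auto
    then show "\<exists>d>0. \<forall>P :: (real \<times> real) set.
        finite P \<and> (\<forall>(s, t)\<in>P. a \<le> s \<and> s < t \<and> t \<le> b) \<and>
        disjoint_family_on (\<lambda>(s, t). {s<..<t}) P \<and> (\<Sum>(s, t)\<in>P. t - s) < d
        \<longrightarrow> (\<Sum>(s, t)\<in>P. norm (t - s)) < e"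
      using e by (intro exI[of _ e]) auto
  qed
  have "bounded (f' ` {a..b})"
    using cont by (auto intro!: compact_imp_bounded compact_continuous_image)
  then obtain B where B: "B > 0" "\<And>x. x \<in> {a..b} \<Longrightarrow> norm (f' x) \<le> B"
    unfolding bounded_pos by auto
  have lip: "norm (f t - f s) \<le> B * norm (t - s)" if "s \<in> {a..b}" "t \<in> {a..b}" for s t
  proof (rule differentiable_bound[of "{a..b}" f "\<lambda>x h. h *\<^sub>R f' x"])
    show "(f has_derivative (\<lambda>h. h *\<^sub>R f' x)) (at x within {a..b})" if "x \<in> {a..b}" for x
      using der[OF that] by (simp add: has_vector_derivative_def)
    show "onorm (\<lambda>h. h *\<^sub>R f' x) \<le> B" if "x \<in> {a..b}" for x
      using B(1) B(2)[OF that] by (intro onorm_le) (auto simp: mult.commute[of B] intro!: mult_left_mono)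
  qed (use that in auto)
  have "norm (f t - f s) \<le> B * (norm (t - s) + norm (t - s))" if "s \<in> {a..b}" "t \<in> {a..b}" for s t
    using B(1) by (intro order_trans[OF lip[OF that]] mult_left_mono) auto
  then show ?thesis
    by (rule abs_continuous_dominated[OF id id B(1)])
qed

lemma sum_length_disjoint_intervals_le:
  fixes P :: "(real \<times> real) set"
  assumes "finite P" "\<And>s t. (s, t) \<in> P \<Longrightarrow> s < t" "disjoint_family_on (\<lambda>(s, t). {s<..<t}) P"
    and "\<And>s t. (s, t) \<in> P \<Longrightarrow> {s<..<t} \<subseteq> U" "U \<in> lmeasurable"
  shows "(\<Sum>(s, t)\<in>P. t - s) \<le> measure lebesgue U"
proof -
  let ?I = "\<lambda>(s::real, t). {s<..<t}"
  have "(\<Sum>(s, t)\<in>P. t - s) = (\<Sum>k\<in>P. measure lebesgue (?I k))"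
    using assms(2) by (intro sum.cong) (fastforce simp: less_imp_le)+
  also have "\<dots> = measure lebesgue (\<Union>k\<in>P. ?I k)"
  proof (rule measure_finite_Union[symmetric, OF assms(1) _ assms(3)])
    show "emeasure lebesgue (?I k) \<noteq> \<infinity>" if "k \<in> P" for k
      using assms(2) that by (cases k) (auto simp: less_imp_le)
  qed auto
  also have "\<dots> \<le> measure lebesgue U"
  proof (rule measure_mono_fmeasurable[OF _ _ assms(5)])
    show "(\<Union>k\<in>P. ?I k) \<subseteq> U" using assms(4) by fast
    show "(\<Union>k\<in>P. ?I k) \<in> sets lebesgue" using assms(1) by (intro sets.finite_UN) auto
  qed
  finally show ?thesis .
qed

text \<open>
  Take a gauge adapted to both kinds of points: at a point with zero derivative it makes the
  increments of \<open>f\<close> small relative to the length, and at a point of the exceptional null set it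
  stays inside an open set of small measure. In a tagged division fine for this gauge, the
  intervals of the first kind contribute little by the slope bound, and those of the second kind
  have small total length and contribute little by absolute continuity.
\<close>

lemma abs_continuous_zero_derivative_constant:
  fixes f :: "real \<Rightarrow> 'a::real_normed_vector"
  assumes ac: "abs_continuous_on_interval a b f"
    and N: "negligible N"
    and der: "\<And>x. x \<in> {a..b} - N \<Longrightarrow> (f has_vector_derivative 0) (at x within {a..b})"
    and c: "c \<in> {a..b}"
  shows "f c = f a"
proof -
  have "norm (f c - f a) \<le> e * (c - a) + e" if e: "e > 0" for e
  proof -
    obtain d where d: "d > 0" "\<And>P :: (real \<times> real) set.
        finite P \<Longrightarrow> \<forall>(s, t)\<in>P. a \<le> s \<and> s < t \<and> t \<le> b \<Longrightarrow>
        disjoint_family_on (\<lambda>(s, t). {s<..<t}) P \<Longrightarrow> (\<Sum>(s, t)\<in>P. t - s) < d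
        \<Longrightarrow> (\<Sum>(s, t)\<in>P. norm (f t - f s)) < e"
    by (rule abs_continuousE[OF ac e]) blast
    have null: "N \<in> null_sets lebesgue" using N by (simp add: negligible_iff_null_sets)
    then obtain U where U: "open U" "N \<subseteq> U" "U - N \<in> lmeasurable"
      "emeasure lebesgue (U - N) < ennreal d"
      using sets_lebesgue_outer_open[of N d] d(1) by auto
    have Um: "U \<in> lmeasurable" and Ud: "measure lebesgue U < d"
    proof -
      have "emeasure lebesgue U = emeasure lebesgue (U - N)"
        using emeasure_Diff_null_set[OF null, of U] U(1) by auto
      with U(4) have *: "emeasure lebesgue U < ennreal d" by simp
      then show "U \<in> lmeasurable"
        using U(1) by (intro fmeasurableI) (auto intro: less_trans)
      then show "measure lebesgue U < d"
        using * d(1) by (simp add: emeasure_eq_measure2 ennreal_less_iff)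
    qed
    have "\<exists>r>0. (x \<in> N \<longrightarrow> ball x r \<subseteq> U) \<and>
        (x \<in> {a..b} - N \<longrightarrow> (\<forall>y\<in>{a..b}. \<bar>y - x\<bar> < r \<longrightarrow> norm (f y - f x) \<le> e * \<bar>y - x\<bar>))" for x
    proof (cases "x \<in> N")
      case True
      then show ?thesis using U openE by blast
    next
      case False
      show ?thesis
      proof (cases "x \<in> {a..b}")
        case True
        then show ?thesis
          using der[of x] False e unfolding has_vector_derivative_def has_derivative_within_alt
          by auto
      qed (use False in \<open>auto intro: exI[of _ 1]\<close>)
    qed
    then obtain r where r: "\<And>x. r x > 0" "\<And>x. x \<in> N \<Longrightarrow> ball x (r x) \<subseteq> U"
      "\<And>x y. x \<in> {a..b} - N \<Longrightarrow> y \<in> {a..b} \<Longrightarrow> \<bar>y - x\<bar> < r x \<Longrightarrow> norm (f y - f x) \<le> e * \<bar>y - x\<bar>"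
      by metis
    have "gauge (\<lambda>x. ball x (r x))" using r(1) by (auto intro: gauge_ball_dependent)
    then obtain p where p: "p tagged_division_of {a..c}" "(\<lambda>x. ball x (r x)) fine p"
      by (rule fine_division_exists_real)
    have fin: "finite p" using p by blast
    have cell: "K = {Inf K..Sup K} \<and> a \<le> Inf K \<and> Inf K \<le> x \<and> x \<le> Sup K \<and> Sup K \<le> c \<and>
        K \<subseteq> ball x (r x)"
      if xK: "(x, K) \<in> p" for x K
    proof -
      obtain u v where uv: "K = cbox u v" using tagged_division_ofD(4)[OF p(1) xK] by blast
      have x: "x \<in> K" "K \<subseteq> {a..c}" using tagged_division_ofD(2,3)[OF p(1) xK] by auto
      then have "u \<le> v" using uv by auto
      then have "Inf K = u" "Sup K = v" using uv by auto
      moreover have "K \<subseteq> ball x (r x)" using p(2) xK by (auto simp: fine_def)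
      ultimately show ?thesis using x uv \<open>u \<le> v\<close> by auto
    qed
    have total: "(\<Sum>(x, K)\<in>p. h (Sup K) - h (Inf K)) = h c - h a"
      for h :: "real \<Rightarrow> 'b::real_normed_vector"
      using c p(1) by (intro additive_tagged_division_1) auto
    define G where "G = {(x, K) \<in> p. x \<notin> N}"
    \<comment> \<open>Degenerate cells contribute nothing; without them, a cell is determined by its endpoints.\<close>
    define B where "B = {(x, K) \<in> p. x \<in> N \<and> Inf K < Sup K}"
    have finGB: "finite G" "finite B" using fin by (auto simp: G_def B_def intro: finite_subset)
    have good: "(\<Sum>(x, K)\<in>G. norm (f (Sup K) - f (Inf K))) \<le> e * (c - a)"
    proof -
      have "norm (f (Sup K) - f (Inf K)) \<le> e * (Sup K - Inf K)" if xK: "(x, K) \<in> G" for x K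
      proof -
        have xp: "(x, K) \<in> p" "x \<notin> N" using xK by (auto simp: G_def)
        note k = cell[OF xp(1)]
        have in_ball: "Inf K \<in> ball x (r x)" "Sup K \<in> ball x (r x)"
          using k by (metis atLeastAtMost_iff order_refl order_trans subsetD)+
        have "norm (f (Sup K) - f (Inf K)) \<le> norm (f (Sup K) - f x) + norm (f (Inf K) - f x)"
          by (metis dist_norm dist_triangle2)
        also have "\<dots> \<le> e * \<bar>Sup K - x\<bar> + e * \<bar>Inf K - x\<bar>"
          using k c xp in_ball by (intro add_mono r(3)) (auto simp: dist_real_def abs_minus_commute)
        also have "\<dots> = e * (Sup K - Inf K)" using k by (simp add: algebra_simps)
        finally show ?thesis .
      qed
      then have "(\<Sum>(x, K)\<in>G. norm (f (Sup K) - f (Inf K))) \<le> (\<Sum>(x, K)\<in>G. e * (Sup K - Inf K))"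
        by (intro sum_mono) auto
      also have "\<dots> \<le> (\<Sum>(x, K)\<in>p. e * (Sup K - Inf K))"
        using fin e cell by (intro sum_mono2) (fastforce simp: G_def intro!: mult_nonneg_nonneg)+
      also have "\<dots> = e * (c - a)"
        using total[of "\<lambda>x. x"] by (simp add: sum_distrib_left[symmetric] case_prod_unfold)
      finally show ?thesis .
    qed
    have bad: "(\<Sum>(x, K)\<in>B. norm (f (Sup K) - f (Inf K))) < e"
    proof -
      let ?ends = "\<lambda>(x::real, K::real set). (Inf K, Sup K)"
      have disj: "{Inf K<..<Sup K} \<inter> {Inf K'<..<Sup K'} = {}"
        if "(x, K) \<in> B" "(x', K') \<in> B" "(x, K) \<noteq> (x', K')" for x K x' K'
      proof -
        have m: "(x, K) \<in> p" "(x', K') \<in> p" using that by (auto simp: B_def)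
        have "{Inf K<..<Sup K} = interior K" "{Inf K'<..<Sup K'} = interior K'"
          using cell[OF m(1)] cell[OF m(2)] by (metis interior_atLeastAtMost_real)+
        then show ?thesis using tagged_division_ofD(5)[OF p(1) m that(3)] by simp
      qed
      have inj: "inj_on ?ends B"
      proof (rule inj_onI, rule ccontr)
        fix k k' assume k: "k \<in> B" "k' \<in> B" "?ends k = ?ends k'" "k \<noteq> k'"
        obtain x K x' K' where [simp]: "k = (x, K)" "k' = (x', K')" by fastforce
        from disj[of x K x' K'] k have "{Inf K<..<Sup K} = {}" by auto
        with k(1) show False by (auto simp: B_def)
      qed
      let ?P = "?ends ` B"
      have P: "finite ?P" "\<forall>(s, t)\<in>?P. a \<le> s \<and> s < t \<and> t \<le> b"
        "disjoint_family_on (\<lambda>(s, t). {s<..<t}) ?P"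
      proof -
        show "finite ?P" using finGB by simp
        show "\<forall>(s, t)\<in>?P. a \<le> s \<and> s < t \<and> t \<le> b" using cell c by (fastforce simp: B_def)
        show "disjoint_family_on (\<lambda>(s, t). {s<..<t}) ?P"
          unfolding disjoint_family_on_def using disj by fastforce
      qed
      have "(\<Sum>(s, t)\<in>?P. t - s) \<le> measure lebesgue U"
      proof (rule sum_length_disjoint_intervals_le[OF P(1) _ P(3) _ Um])
        show "s < t" if "(s, t) \<in> ?P" for s t using P(2) that by blast
        show "{s<..<t} \<subseteq> U" if st: "(s, t) \<in> ?P" for s t
        proof -
          obtain x K where k: "(x, K) \<in> p" "x \<in> N" "s = Inf K" "t = Sup K"
            using st by (auto simp: B_def)
          have "{s<..<t} \<subseteq> K" 
            using cell[OF k(1)] k(3,4) greaterThanLessThan_subseteq_atLeastAtMost_iff by blast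
          also have "K \<subseteq> ball x (r x)" using cell[OF k(1)] by blast
          also have "\<dots> \<subseteq> U" by (rule r(2)[OF k(2)])
          finally show ?thesis .
        qed
      qed
      then have "(\<Sum>(s, t)\<in>?P. norm (f t - f s)) < e"
        using Ud P by (intro d(2)) auto
      also have "(\<Sum>(s, t)\<in>?P. norm (f t - f s)) = (\<Sum>(x, K)\<in>B. norm (f (Sup K) - f (Inf K)))"
        by (subst sum.reindex[OF inj]) (simp add: case_prod_unfold o_def)
      finally show ?thesis .
    qed
    have "f c - f a = (\<Sum>(x, K)\<in>p. f (Sup K) - f (Inf K))" using total[of f] by simp
    also have "norm \<dots> \<le> (\<Sum>(x, K)\<in>p. norm (f (Sup K) - f (Inf K)))"
      by (rule order_trans[OF norm_sum]) (simp add: case_prod_unfold)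
    also have "\<dots> = (\<Sum>(x, K)\<in>G \<union> B. norm (f (Sup K) - f (Inf K)))"
    proof (rule sum.mono_neutral_right[OF fin])
      show "G \<union> B \<subseteq> p" by (auto simp: G_def B_def)
      show "\<forall>k\<in>p - (G \<union> B). (case k of (x, K) \<Rightarrow> norm (f (Sup K) - f (Inf K))) = 0"
      proof
        fix k assume k: "k \<in> p - (G \<union> B)"
        obtain x K where [simp]: "k = (x, K)" by fastforce
        have "Inf K = Sup K" using k cell[of x K] by (auto simp: G_def B_def)
        then show "(case k of (x, K) \<Rightarrow> norm (f (Sup K) - f (Inf K))) = 0" by simp
      qed
    qed
    also have "\<dots> = (\<Sum>(x, K)\<in>G. norm (f (Sup K) - f (Inf K))) + (\<Sum>(x, K)\<in>B. norm (f (Sup K) - f (Inf K)))"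
      using finGB by (intro sum.union_disjoint) (auto simp: G_def B_def)
    also have "\<dots> \<le> e * (c - a) + e" using good bad by simp
    finally show ?thesis .
  qed
  then have lim: "norm (f c - f a) \<le> e * (c - a + 1)" if "e > 0" for e
    using that by (simp add: distrib_left)
  have "norm (f c - f a) \<le> 0"
  proof (rule field_le_epsilon)
    fix e :: real assume "e > 0"
    then show "norm (f c - f a) \<le> 0 + e"
      using lim[of "e / (c - a + 1)"] c by simp
  qed
  then show ?thesis by simp
qed

section \<open>The derivative on the interval and the space \<open>H\<^sup>2\<close>\<close>

lemma D_works:
  assumes "y differentiable (at x within {0..pi})"
  shows "(y has_vector_derivative D y x) (at x within {0..pi})"
  using assms unfolding D_def by (simp add: vector_derivative_works)

lemma D_eqI:
  assumes "(y has_vector_derivative d) (at x within {0..pi})" "x \<in> {0..pi}"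
  shows "D y x = d"
  using assms vector_derivative_within_cbox[of 0 pi x y d] unfolding D_def by simp

text \<open>
  The coefficient \<open>g\<^sub>0\<close> is tied to \<open>\<phi>(0, \<cdot>) - 1\<close> only on the interval and is arbitrary elsewhere, so
  derivatives and \<open>H\<^sup>2\<close> regularity are transferred between functions that differ by a constant
  there. The case of constant zero also serves for the derivatives themselves.
\<close>

lemma has_vector_derivative_shift_iff:
  assumes "\<And>x. x \<in> S \<Longrightarrow> z x = y x + c" "x \<in> S"
  shows "(z has_vector_derivative d) (at x within S) \<longleftrightarrow> (y has_vector_derivative d) (at x within S)"
proof
  assume "(z has_vector_derivative d) (at x within S)"
  then have "((\<lambda>x. z x - c) has_vector_derivative d) (at x within S)"
    using has_vector_derivative_diff_const by blast
  then show "(y has_vector_derivative d) (at x within S)"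
    by (rule has_vector_derivative_transform[OF assms(2), rotated]) (simp add: assms(1))
next
  assume "(y has_vector_derivative d) (at x within S)"
  then have "((\<lambda>x. y x + c) has_vector_derivative d) (at x within S)"
    using has_vector_derivative_add_const by blast
  then show "(z has_vector_derivative d) (at x within S)"
    by (rule has_vector_derivative_transform[OF assms(2), rotated]) (simp add: assms(1))
qed

lemma D_shift:
  assumes "\<And>x. x \<in> {0..pi} \<Longrightarrow> z x = y x + c" "x \<in> {0..pi}"
  shows "D z x = D y x"
  using has_vector_derivative_shift_iff[OF assms] unfolding D_def vector_derivative_def by simp

lemma differentiable_shift:
  fixes z y :: "real \<Rightarrow> 'a::real_normed_vector"
  assumes "\<And>x. x \<in> {0..pi} \<Longrightarrow> z x = y x + c" "x \<in> {0..pi}"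
  shows "z differentiable (at x within {0..pi}) \<longleftrightarrow> y differentiable (at x within {0..pi})"
  using has_vector_derivative_shift_iff[OF assms] D_shift[OF assms]
  unfolding D_def vector_derivative_works by simp

lemma in_H2_shift:
  fixes y z :: "real \<Rightarrow> 'a::euclidean_space"
  assumes y: "in_H2 y" and z: "\<And>x. x \<in> {0..pi} \<Longrightarrow> z x = y x + c"
  shows "in_H2 z"
proof -
  have D1: "D z x = D y x + 0" if "x \<in> {0..pi}" for x
    using D_shift[OF z that] by simp
  have D2: "D (D z) x = D (D y) x" if "x \<in> {0..pi}" for x
    using D_shift[OF D1 that] .
  have "(AE x in lebesgue_on {0..pi}. D z differentiable (at x within {0..pi})) \<longleftrightarrow>
        (AE x in lebesgue_on {0..pi}. D y differentiable (at x within {0..pi}))"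
    by (intro AE_cong differentiable_shift[where c = 0] D1) auto
  moreover have "square_integrable_on_interval (D (D z))"
  proof -
    have "D (D z) \<in> borel_measurable (lebesgue_on {0..pi}) \<longleftrightarrow>
          D (D y) \<in> borel_measurable (lebesgue_on {0..pi})"
      by (intro measurable_cong) (simp add: D2)
    moreover have "integrable (lebesgue_on {0..pi}) (\<lambda>x. (norm (D (D z) x))\<^sup>2) \<longleftrightarrow>
          integrable (lebesgue_on {0..pi}) (\<lambda>x. (norm (D (D y) x))\<^sup>2)"
      by (intro Bochner_Integration.integrable_cong refl) (simp add: D2)
    ultimately show ?thesis
      using y by (simp add: in_H2_def square_integrable_on_interval_def)
  qed
  moreover have "abs_continuous_on_interval 0 pi (D z)"
    using y D1 by (auto simp: in_H2_def intro: abs_continuous_cong)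
  ultimately show ?thesis
    using y differentiable_shift[OF z] by (auto simp: in_H2_def)
qed

text \<open>
  The Wronskian argument needs only these three properties of the square root, and they are the
  ones that carry over from \<open>F\<close> because \<open>(\<surd>F)' = F' / (2 \<surd>F)\<close> is the product of \<open>F'\<close> with a
  continuously differentiable factor.
\<close>

lemma sqrt_H2_regularity:
  fixes F a :: "real \<Rightarrow> real"
  assumes F: "in_H2 F" and pos: "\<And>x. x \<in> {0..pi} \<Longrightarrow> F x > 0"
    and a: "\<And>x. x \<in> {0..pi} \<Longrightarrow> a x = sqrt (F x)"
  shows "\<And>x. x \<in> {0..pi} \<Longrightarrow> (a has_vector_derivative D a x) (at x within {0..pi})"
    and "abs_continuous_on_interval 0 pi (D a)"
    and "AE x in lebesgue_on {0..pi}. D a differentiable (at x within {0..pi})"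
proof -
  \<comment> \<open>equal to \<open>1 / (2 a)\<close>, hence \<open>r' = - 2 r\<^sup>2 a'\<close> with \<open>a' = r F'\<close>\<close>
  define r where "r = (\<lambda>x. inverse (2 * sqrt (F x)))"
  have dF: "(F has_real_derivative D F x) (at x within {0..pi})" if "x \<in> {0..pi}" for x
    using F that D_works[of F x] by (auto simp: in_H2_def has_real_derivative_iff_has_vector_derivative)
  have acF: "abs_continuous_on_interval 0 pi (D F)" using F by (simp add: in_H2_def)
  have contDF: "continuous_on {0..pi} (D F)" by (rule abs_continuous_imp_continuous_on[OF acF])
  have contF: "continuous_on {0..pi} F"
    by (rule DERIV_continuous_on[OF dF])
  have dsqrt: "((\<lambda>x. sqrt (F x)) has_real_derivative r x * D F x) (at x within {0..pi})"
    if "x \<in> {0..pi}" for x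
    using pos[OF that] DERIV_chain2[OF DERIV_real_sqrt dF[OF that]]
    by (simp add: r_def field_simps)
  have da: "(a has_vector_derivative r x * D F x) (at x within {0..pi})" if "x \<in> {0..pi}" for x
    using dsqrt[OF that] unfolding has_real_derivative_iff_has_vector_derivative
    by (rule has_vector_derivative_transform[OF that, rotated]) (rule a)
  have Da: "D a x = r x *\<^sub>R D F x" if "x \<in> {0..pi}" for x
    using D_eqI[OF da[OF that] that] by simp
  show "(a has_vector_derivative D a x) (at x within {0..pi})" if "x \<in> {0..pi}" for x
    using da[OF that] Da[OF that] by simp
  define r' where "r' = (\<lambda>x. - (r x * (2 * (r x * D F x)) * r x))"
  have dr: "(r has_vector_derivative r' x) (at x within {0..pi})" if "x \<in> {0..pi}" for x
  proof -
    have "((\<lambda>x. 2 * sqrt (F x)) has_real_derivative 2 * (r x * D F x)) (at x within {0..pi})"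
      by (rule DERIV_cmult[OF dsqrt[OF that]])
    moreover have "2 * sqrt (F x) \<noteq> 0" using pos[OF that] by simp
    ultimately show ?thesis
      unfolding has_real_derivative_iff_has_vector_derivative[symmetric] r'_def
      using DERIV_inverse'[of "\<lambda>x. 2 * sqrt (F x)"] by (simp add: r_def)
  qed
  have contr: "continuous_on {0..pi} r"
    unfolding r_def using pos by (intro continuous_intros contF) force
  have acr: "abs_continuous_on_interval 0 pi r"
    by (rule continuous_derivative_imp_abs_continuous[OF dr])
      (auto simp: r'_def intro!: continuous_intros contr contDF)
  show "abs_continuous_on_interval 0 pi (D a)"
    using abs_continuous_scaleR[OF acr acF] by (rule abs_continuous_cong) (rule Da)
  have "AE x in lebesgue_on {0..pi}. D F differentiable (at x within {0..pi})"
    using F by (simp add: in_H2_def)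
  then show "AE x in lebesgue_on {0..pi}. D a differentiable (at x within {0..pi})"
  proof (rule AE_mp, intro AE_I2 impI)
    fix x assume x: "x \<in> space (lebesgue_on {0..pi})"
      and d: "D F differentiable (at x within {0..pi})"
    then have x': "x \<in> {0..pi}" by simp
    have "((\<lambda>x. r x *\<^sub>R D F x) has_vector_derivative (r x *\<^sub>R D (D F) x + r' x *\<^sub>R D F x))
        (at x within {0..pi})"
      using dr[OF x'] D_works[OF d] by (intro has_vector_derivative_scaleR)
        (auto simp: has_real_derivative_iff_has_vector_derivative)
    then have "(D a has_vector_derivative (r x *\<^sub>R D (D F) x + r' x *\<^sub>R D F x)) (at x within {0..pi})"
      by (rule has_vector_derivative_transform[OF x', rotated]) (rule Da)
    then show "D a differentiable (at x within {0..pi})"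
      unfolding has_vector_derivative_def differentiable_def by blast
  qed
qed

section \<open>Proportionality of two solutions\<close>

text \<open>
  Uniqueness for the initial value problem of the same second-order equation, in the case where
  one solution is known to have no zero: the Wronskian is constant, hence zero, and it is
  the numerator of \<open>(y / a)'\<close>.
\<close>

lemma solution_proportional_to_nonvanishing_solution:
  fixes a q :: "real \<Rightarrow> real" and y :: "real \<Rightarrow> complex"
  assumes da: "\<And>x. x \<in> {0..pi} \<Longrightarrow> (a has_vector_derivative D a x) (at x within {0..pi})"
    and acDa: "abs_continuous_on_interval 0 pi (D a)"
    and ddA: "AE x in lebesgue_on {0..pi}. D a differentiable (at x within {0..pi})"
    and nz: "\<And>x. x \<in> {0..pi} \<Longrightarrow> a x \<noteq> 0"
    and q: "AE x in lebesgue_on {0..pi}. q x = D (D a) x / a x"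
    and y: "in_H2 y"
    and eq: "AE x in lebesgue_on {0..pi}. D (D y) x = complex_of_real (q x) * y x"
    and init: "a 0 *\<^sub>R D y 0 = D a 0 *\<^sub>R y 0"
    and x: "x \<in> {0..pi}"
  shows "a 0 *\<^sub>R y x = a x *\<^sub>R y 0"
proof -
  have dy: "(y has_vector_derivative D y x) (at x within {0..pi})" if "x \<in> {0..pi}" for x
    using y that by (auto simp: in_H2_def intro: D_works)
  have acDy: "abs_continuous_on_interval 0 pi (D y)" using y by (simp add: in_H2_def)
  have aca: "abs_continuous_on_interval 0 pi a"
    by (rule continuous_derivative_imp_abs_continuous[OF da abs_continuous_imp_continuous_on[OF acDa]])
  have acy: "abs_continuous_on_interval 0 pi y"
    by (rule continuous_derivative_imp_abs_continuous[OF dy abs_continuous_imp_continuous_on[OF acDy]])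
  define w where "w = (\<lambda>x. a x *\<^sub>R D y x - D a x *\<^sub>R y x)"
  have acw: "abs_continuous_on_interval 0 pi w"
    unfolding w_def by (intro abs_continuous_diff abs_continuous_scaleR aca acDy acDa acy)
  have dw: "AE x in lebesgue_on {0..pi}. (w has_vector_derivative 0) (at x within {0..pi})"
  proof -
    have "AE x in lebesgue_on {0..pi}. D y differentiable (at x within {0..pi})"
      using y by (simp add: in_H2_def)
    with ddA q eq AE_space show ?thesis
    proof eventually_elim
      case (elim x)
      then have x: "x \<in> {0..pi}" by simp
      have "(w has_vector_derivative
          (a x *\<^sub>R D (D y) x + D a x *\<^sub>R D y x) - (D a x *\<^sub>R D y x + D (D a) x *\<^sub>R y x))
          (at x within {0..pi})"
        unfolding w_def using da[OF x] dy[OF x] D_works[OF elim(1)] D_works[OF elim(5)]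
        by (intro has_vector_derivative_diff has_vector_derivative_scaleR)
          (auto simp: has_real_derivative_iff_has_vector_derivative)
      moreover have "a x *\<^sub>R D (D y) x = D (D a) x *\<^sub>R y x"
        using elim(2,3) nz[OF x] by (simp add: scaleR_conv_of_real)
      ultimately show ?case by simp
    qed
  qed
  have w0: "w x = 0" if "x \<in> {0..pi}" for x
  proof -
    have "AE x in lebesgue. x \<in> {0..pi} \<longrightarrow> (w has_vector_derivative 0) (at x within {0..pi})"
      using dw by (simp add: AE_restrict_space_iff)
    then obtain N where N: "N \<in> null_sets lebesgue"
      "\<And>x. x \<in> {0..pi} \<Longrightarrow> x \<notin> N \<Longrightarrow> (w has_vector_derivative 0) (at x within {0..pi})"
      by (rule AE_E3) auto
    have "w x = w 0"
    proof (rule abs_continuous_zero_derivative_constant[OF acw _ _ that])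
      show "negligible N" using N(1) by (simp add: negligible_iff_null_sets)
      show "(w has_vector_derivative 0) (at x within {0..pi})" if "x \<in> {0..pi} - N" for x
        using N(2) that by blast
    qed
    then show ?thesis using init by (simp add: w_def)
  qed
  have "((\<lambda>x. inverse (a x) *\<^sub>R y x) has_vector_derivative 0) (at x within {0..pi})"
    if "x \<in> {0..pi}" for x
  proof -
    have "((\<lambda>x. inverse (a x)) has_real_derivative - (inverse (a x) * D a x * inverse (a x)))
        (at x within {0..pi})"
      using da[OF that] nz[OF that]
      by (intro DERIV_inverse') (simp_all add: has_real_derivative_iff_has_vector_derivative)
    from has_vector_derivative_scaleR[OF this dy[OF that]]
    have "((\<lambda>x. inverse (a x) *\<^sub>R y x) has_vector_derivative
        (inverse (a x) *\<^sub>R D y x + (- (inverse (a x) * D a x * inverse (a x))) *\<^sub>R y x))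
        (at x within {0..pi})" .
    also have "inverse (a x) *\<^sub>R D y x + (- (inverse (a x) * D a x * inverse (a x))) *\<^sub>R y x
        = (inverse (a x) * inverse (a x)) *\<^sub>R w x"
      using nz[OF that] by (simp add: w_def scaleR_diff_right field_simps)
    finally show ?thesis using w0[OF that] by simp
  qed
  then obtain k where k: "\<And>x. x \<in> {0..pi} \<Longrightarrow> inverse (a x) *\<^sub>R y x = k"
    using has_vector_derivative_zero_constant[of "{0..pi}" "\<lambda>x. inverse (a x) *\<^sub>R y x"] by auto
  have yk: "y x = a x *\<^sub>R k" if "x \<in> {0..pi}" for x
    using k[OF that] nz[OF that] by (metis scaleR_scaleR right_inverse scaleR_one)
  show ?thesis using yk[OF x] yk[of 0] by (simp add: mult.commute)
qed

section \<open>The Neumann series at the spectral parameter zero\<close>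

lemma spherical_bessel_j_zero: "spherical_bessel_j k 0 = (if k = 0 then 1 else 0)"
proof (cases "k = 0")
  case True
  have "(\<Sum>m. (- ((0::complex)\<^sup>2 / 2)) ^ m / (fact m * of_nat (\<Prod>i\<le>m. 2 * i + 1)))
      = (\<Sum>m\<in>{0}. (- ((0::complex)\<^sup>2 / 2)) ^ m / (fact m * of_nat (\<Prod>i\<le>m. 2 * i + 1)))"
    by (rule suminf_finite) auto
  with True show ?thesis by (simp add: spherical_bessel_j_def)
qed (simp add: spherical_bessel_j_def)

lemma nsbf_first_coefficient:
  assumes "nsbf_representation \<phi> g" "x \<in> {0..pi}"
  shows "g 0 x = \<phi> 0 x - 1"
proof -
  have "nsbf_term g 0 x sums (\<phi> 0 x - 1)"
    using assms unfolding nsbf_representation_def by (metis cos_zero mult_zero_left)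
  moreover have "nsbf_term g 0 x sums (\<Sum>n\<in>{0}. nsbf_term g 0 x n)"
    by (rule sums_finite) (auto simp: nsbf_term_def spherical_bessel_j_zero)
  ultimately show ?thesis
    using sums_unique2 by (force simp: nsbf_term_def spherical_bessel_j_zero)
qed

section \<open>Recovery of the coefficients\<close>

theorem mainTheorem1:
  fixes F a q :: "real \<Rightarrow> real" and h :: real
    and \<phi> :: "complex \<Rightarrow> real \<Rightarrow> complex" and g :: "nat \<Rightarrow> real \<Rightarrow> complex"
  assumes F_H2: "in_H2 F"
    and F_pos: "\<And>x. x \<in> {0..pi} \<Longrightarrow> F x > 0"
    and a_eq: "\<And>x. x \<in> {0..pi} \<Longrightarrow> a x = sqrt (F x)"
    and q_eq: "AE x in lebesgue_on {0..pi}. q x = D (D a) x / a x"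
    and h_eq: "h = D a 0 / a 0"
    and \<phi>_sol: "\<And>\<rho>. caratheodory_solution q \<rho> (\<phi> \<rho>)"
    and \<phi>_0: "\<And>\<rho>. \<phi> \<rho> 0 = 1"
    and \<phi>'_0: "\<And>\<rho>. D (\<phi> \<rho>) 0 = complex_of_real h"
    and nsbf: "nsbf_representation \<phi> g"
  shows "in_H2 (g 0)
    \<and> (AE x in lebesgue_on {0..pi}. complex_of_real (q x) = D (D (g 0)) x / (g 0 x + 1))
    \<and> complex_of_real h = D (g 0) 0
    \<and> (\<forall>x\<in>{0..pi}. complex_of_real (a x) = complex_of_real (sqrt (F 0)) * (g 0 x + 1))
    \<and> (\<forall>x\<in>{0..pi}. complex_of_real (F x) = complex_of_real (F 0) * (g 0 x + 1)\<^sup>2)"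
proof -
  define y where "y = \<phi> 0"
  have y: "in_H2 y"
    and eq: "AE x in lebesgue_on {0..pi}. D (D y) x = complex_of_real (q x) * y x"
    using \<phi>_sol[of 0] by (auto simp: caratheodory_solution_def y_def)
  have y0: "y 0 = 1" "D y 0 = complex_of_real h" using \<phi>_0 \<phi>'_0 by (auto simp: y_def)
  have g0: "g 0 x = y x + (- 1)" if "x \<in> {0..pi}" for x
    using nsbf_first_coefficient[OF nsbf that] by (simp add: y_def)
  have a_pos: "a x > 0" if "x \<in> {0..pi}" for x using F_pos[OF that] a_eq[OF that] by simp
  have a_y: "complex_of_real (a x) = complex_of_real (a 0) * y x" if "x \<in> {0..pi}" for x
  proof -
    have "a 0 *\<^sub>R D y 0 = D a 0 *\<^sub>R y 0"
      using a_pos[of 0] h_eq by (simp add: y0 scaleR_conv_of_real)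
    moreover have "\<And>x. x \<in> {0..pi} \<Longrightarrow> a x \<noteq> 0" using a_pos by force
    ultimately have "a 0 *\<^sub>R y x = a x *\<^sub>R y 0"
      using sqrt_H2_regularity[OF F_H2 F_pos a_eq] q_eq y eq that
      by (intro solution_proportional_to_nonvanishing_solution[of a q y x]) auto
    then show ?thesis by (simp add: y0 scaleR_conv_of_real)
  qed
  have D1: "D (g 0) x = D y x + 0" if "x \<in> {0..pi}" for x
    using D_shift[OF g0 that] by simp
  have D2: "D (D (g 0)) x = D (D y) x" if "x \<in> {0..pi}" for x
    by (rule D_shift[OF D1 that])
  have q_g: "AE x in lebesgue_on {0..pi}. complex_of_real (q x) = D (D (g 0)) x / (g 0 x + 1)"
    using eq
  proof (rule AE_mp, intro AE_I2 impI)
    fix x assume "x \<in> space (lebesgue_on {0..pi})" and e: "D (D y) x = complex_of_real (q x) * y x"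
    then have x: "x \<in> {0..pi}" by simp
    have "y x \<noteq> 0" using a_y[OF x] a_pos[OF x] by auto
    then show "complex_of_real (q x) = D (D (g 0)) x / (g 0 x + 1)"
      using e by (simp add: D2[OF x] g0[OF x])
  qed
  have a_g: "complex_of_real (a x) = complex_of_real (sqrt (F 0)) * (g 0 x + 1)"
    if "x \<in> {0..pi}" for x
    using a_y[OF that] a_eq[of 0] g0[OF that] by simp
  have F_g: "complex_of_real (F x) = complex_of_real (F 0) * (g 0 x + 1)\<^sup>2"
    if "x \<in> {0..pi}" for x
  proof -
    have sq: "F z = (a z)\<^sup>2" if "z \<in> {0..pi}" for z
      using F_pos[OF that] a_eq[OF that] by simp
    show ?thesis
      using sq[OF that] sq[of 0] a_y[OF that] g0[OF that] by (simp add: power_mult_distrib)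
  qed
  have "complex_of_real h = D (g 0) 0" using D1[of 0] y0 by simp
  then show ?thesis
    using in_H2_shift[OF y g0] q_g a_g F_g by blast
qed

end
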